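(* Let $\gamma : I\to\mathbb{R}^3$ be a smooth curve on an open interval $I$ parametrized by arc length $s$, with nowhere vanishing curvature and unit tangent $T$. Let $c$ be a real constant with $c-s>0$ for all $s\in I$, and let $\widetilde\gamma=\gamma+(c-s)T$ be the involute of $\gamma$. Then the following hold. (i) If $\gamma$ is a slant helix, then the tangent indicatrix of its involute $\widetilde\gamma$ is a generalized helix. (ii) If $\widetilde\gamma$ is a slant helix, then the tangent indicatrix of $\widetilde\gamma$ is a spherical slant helix.
   Context: The tangent indicatrix of $\widetilde\gamma$ is the curve traced on the unit sphere by its unit tangent vector $\widetilde T$. For a curve with arc-length parameter $u$, curvature $k>0$ and torsion $t$, put $g=t/k$. The curve is a generalized helix if $g$ is constant (the value $0$ is allowed). The curve is a slant helix if its principal normal lines make a constant angle with a fixed direction; equivalently (known characterization of Izumiya and Takeuchi), the function $\frac{dg/du}{k(1+g^2)^{3/2}}$ is constant. A spherical slant helix is a slant helix lying on the unit sphere. *)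

theory Defs
  imports "HOL-Analysis.Analysis"
begin

text \<open>\<open>C\<^sup>\<infinity>\<close> on an open set \<open>I\<close>: every iterated derivative is differentiable at each point of \<open>I\<close>.\<close>

definition smooth_on :: "real set \<Rightarrow> (real \<Rightarrow> real ^ 3) \<Rightarrow> bool" where
  "smooth_on I f \<longleftrightarrow>
    (\<forall>n. \<forall>t\<in>I. ((\<lambda>h t. vector_derivative h (at t)) ^^ n) f differentiable (at t))"

definition speed :: "(real \<Rightarrow> real ^ 3) \<Rightarrow> real \<Rightarrow> real" where
  "speed \<gamma> t = norm (vector_derivative \<gamma> (at t))"

text \<open>
  The derivative \<open>df/du\<close> of \<open>f\<close> with respect to the arc-length parameter \<open>u\<close> of \<open>\<gamma>\<close>, where
  \<open>du/dt = speed \<gamma> t\<close>, so that the Frenet apparatus makes sense for a regular curve in any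
  parametrization; see \<open>arc_deriv_arc_length\<close> below.
\<close>

definition arc_deriv :: "(real \<Rightarrow> real ^ 3) \<Rightarrow> (real \<Rightarrow> real ^ 3) \<Rightarrow> real \<Rightarrow> real ^ 3" where
  "arc_deriv \<gamma> f t = (1 / speed \<gamma> t) *\<^sub>R vector_derivative f (at t)"

lemma arc_deriv_arc_length:
  assumes u: "(u has_real_derivative speed \<gamma> t) (at t)" and "speed \<gamma> t \<noteq> 0"
    and F: "(F has_vector_derivative F') (at (u t))"
  shows "arc_deriv \<gamma> (\<lambda>t. F (u t)) t = F'"
proof -
  have "((F \<circ> u) has_vector_derivative speed \<gamma> t *\<^sub>R F') (at t)"
    using vector_diff_chain_at[OF u[unfolded has_real_derivative_iff_has_vector_derivative] F] .
  then have "vector_derivative (\<lambda>t. F (u t)) (at t) = speed \<gamma> t *\<^sub>R F'"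
    by (simp add: o_def vector_derivative_at)
  with assms(2) show ?thesis
    by (simp add: arc_deriv_def)
qed

definition unit_tangent :: "(real \<Rightarrow> real ^ 3) \<Rightarrow> real \<Rightarrow> real ^ 3" where
  "unit_tangent \<gamma> = arc_deriv \<gamma> \<gamma>"

definition curvature :: "(real \<Rightarrow> real ^ 3) \<Rightarrow> real \<Rightarrow> real" where
  "curvature \<gamma> t = norm (arc_deriv \<gamma> (unit_tangent \<gamma>) t)"

definition principal_normal :: "(real \<Rightarrow> real ^ 3) \<Rightarrow> real \<Rightarrow> real ^ 3" where
  "principal_normal \<gamma> t = (1 / curvature \<gamma> t) *\<^sub>R arc_deriv \<gamma> (unit_tangent \<gamma>) t"

definition binormal :: "(real \<Rightarrow> real ^ 3) \<Rightarrow> real \<Rightarrow> real ^ 3" where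
  "binormal \<gamma> t = cross3 (unit_tangent \<gamma> t) (principal_normal \<gamma> t)"

text \<open>Sign convention: \<open>dB/du = - torsion N\<close>.\<close>

definition torsion :: "(real \<Rightarrow> real ^ 3) \<Rightarrow> real \<Rightarrow> real" where
  "torsion \<gamma> t = - (arc_deriv \<gamma> (binormal \<gamma>) t \<bullet> principal_normal \<gamma> t)"

definition frenet_curve :: "real set \<Rightarrow> (real \<Rightarrow> real ^ 3) \<Rightarrow> bool" where
  "frenet_curve I \<gamma> \<longleftrightarrow>
    smooth_on I \<gamma> \<and> (\<forall>t\<in>I. speed \<gamma> t > 0) \<and> (\<forall>t\<in>I. curvature \<gamma> t > 0)"

definition generalized_helix :: "real set \<Rightarrow> (real \<Rightarrow> real ^ 3) \<Rightarrow> bool" where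
  "generalized_helix I \<gamma> \<longleftrightarrow>
    frenet_curve I \<gamma> \<and> (\<exists>g. \<forall>t\<in>I. torsion \<gamma> t / curvature \<gamma> t = g)"

text \<open>
  The angle, in \<open>[0, \<pi>/2]\<close>, between the unoriented lines spanned by two nonzero vectors; the
  absolute value makes it independent of the choice of spanning vectors.
\<close>

definition line_angle :: "real ^ 3 \<Rightarrow> real ^ 3 \<Rightarrow> real" where
  "line_angle v d = arccos (\<bar>v \<bullet> d\<bar> / (norm v * norm d))"

definition slant_helix :: "real set \<Rightarrow> (real \<Rightarrow> real ^ 3) \<Rightarrow> bool" where
  "slant_helix I \<gamma> \<longleftrightarrow>
    frenet_curve I \<gamma> \<and>
    (\<exists>d \<theta>. d \<noteq> 0 \<and> (\<forall>t\<in>I. line_angle (principal_normal \<gamma> t) d = \<theta>))"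

definition spherical_slant_helix :: "real set \<Rightarrow> (real \<Rightarrow> real ^ 3) \<Rightarrow> bool" where
  "spherical_slant_helix I \<gamma> \<longleftrightarrow> slant_helix I \<gamma> \<and> \<gamma> ` I \<subseteq> sphere 0 1"

definition tangent_indicatrix :: "(real \<Rightarrow> real ^ 3) \<Rightarrow> real \<Rightarrow> real ^ 3" where
  "tangent_indicatrix \<gamma> = unit_tangent \<gamma>"

definition involute :: "real \<Rightarrow> (real \<Rightarrow> real ^ 3) \<Rightarrow> real \<Rightarrow> real ^ 3" where
  "involute c \<gamma> s = \<gamma> s + (c - s) *\<^sub>R unit_tangent \<gamma> s"

end

theory Submission
  imports Defs
begin

text \<open>
  Write \<open>T\<close>, \<open>N\<close>, \<open>\<kappa>\<close> for the tangent, principal normal and curvature of \<open>\<gamma>\<close>. Since \<open>T' = \<kappa> N\<close>, the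
  involute has velocity \<open>(c - s) \<kappa> N\<close> with a positive factor, so its tangent indicatrix is \<open>N\<close>.

  For the first claim: if \<open>\<gamma>\<close> is a slant helix with axis \<open>d\<close>, then \<open>N \<bullet> d\<close> is constant, that is, the curve \<open>N\<close> lies
  in a plane orthogonal to \<open>d\<close>. A plane curve has torsion \<open>0\<close>, so \<open>N\<close> is a generalized helix with
  \<open>g = 0\<close> (\<open>torsion_eq_0_if_planar\<close>).

  The second claim is an instance of a fact about any slant helix \<open>\<delta>\<close> with axis \<open>d\<close>. The principal normal of
  \<open>\<delta>\<close> is the unit tangent of the tangent indicatrix \<open>\<beta>\<close>, so the component of the tangent of \<open>\<beta>\<close>
  along \<open>d\<close> is locally constant. Differentiating it, the principal normal of \<open>\<beta>\<close> is orthogonal to \<open>d\<close>: it makes the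
  constant angle \<open>\<pi>/2\<close> with the same axis (\<open>spherical_slant_helix_tangent_indicatrix\<close>).

  Two side conditions remain. A regular curve on the unit sphere never has curvature zero, because
  differentiating \<open>\<beta> \<bullet> T\<^sub>\<beta> = 0\<close> gives \<open>\<beta> \<bullet> T\<^sub>\<beta>' = - speed\<close> (\<open>frenet_curve_spherical\<close>). And the
  Frenet vectors are smooth, because each is obtained by differentiating, normalizing a
  nowhere vanishing vector function and taking cross products.
\<close>

section \<open>Functions that are differentiable finitely many times\<close>

text \<open>
  Products and normalization leave the type of space curves, and their smoothness is proved by
  induction on the order; hence a notion with an explicit order and an arbitrary target space.
\<close>

primrec times_differentiable_on ::
  "nat \<Rightarrow> real set \<Rightarrow> (real \<Rightarrow> 'a::real_normed_vector) \<Rightarrow> bool" where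
  "times_differentiable_on 0 I f = True"
| "times_differentiable_on (Suc n) I f \<longleftrightarrow>
     (\<forall>t\<in>I. f differentiable at t) \<and>
     times_differentiable_on n I (\<lambda>t. vector_derivative f (at t))"

lemma times_differentiable_on_iff_funpow:
  "times_differentiable_on n I f \<longleftrightarrow>
    (\<forall>m<n. \<forall>t\<in>I. ((\<lambda>h t. vector_derivative h (at t)) ^^ m) f differentiable (at t))"
  by (induction n arbitrary: f) (simp_all add: All_less_Suc2 funpow_Suc_right o_def del: funpow.simps(2))

lemma smooth_on_iff_times_differentiable_on:
  "smooth_on I f \<longleftrightarrow> (\<forall>n. times_differentiable_on n I f)"
  unfolding smooth_on_def times_differentiable_on_iff_funpow by blast

lemma times_differentiable_on_SucD:
  "times_differentiable_on (Suc n) I f \<Longrightarrow> times_differentiable_on n I f"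
  by (induction n arbitrary: f) auto

lemma times_differentiable_on_has_vector_derivative:
  assumes "times_differentiable_on (Suc n) I f" "t \<in> I"
  shows "(f has_vector_derivative vector_derivative f (at t)) (at t)"
  using assms by (simp add: vector_derivative_works)

lemma times_differentiable_on_cong:
  assumes "open I" "\<And>t. t \<in> I \<Longrightarrow> f t = g t" "times_differentiable_on n I f"
  shows "times_differentiable_on n I g"
  using assms(2,3)
proof (induction n arbitrary: f g)
  case (Suc n)
  have g: "(g has_vector_derivative vector_derivative f (at t)) (at t)" if "t \<in> I" for t
    using has_vector_derivative_transform_within_open[OF _ assms(1) that]
      times_differentiable_on_has_vector_derivative[OF Suc.prems(2) that] Suc.prems(1) by blast
  have "times_differentiable_on n I (\<lambda>t. vector_derivative g (at t))"
    by (rule Suc.IH[of "\<lambda>t. vector_derivative f (at t)"])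
       (use g Suc.prems(2) in \<open>simp_all add: vector_derivative_at[OF g]\<close>)
  then show ?case
    using g by (auto intro: differentiableI_vector)
qed simp

text \<open>
  Since \<open>I\<close> is open, a derivative need only be identified on \<open>I\<close>. This makes every closure
  property below follow from its differentiation rule by induction on the order.
\<close>

lemma times_differentiable_on_SucI:
  assumes "open I" "\<And>t. t \<in> I \<Longrightarrow> (f has_vector_derivative f' t) (at t)"
    and "times_differentiable_on n I f'"
  shows "times_differentiable_on (Suc n) I f"
proof -
  have "times_differentiable_on n I (\<lambda>t. vector_derivative f (at t))"
    by (rule times_differentiable_on_cong[OF assms(1) _ assms(3)])
       (simp add: vector_derivative_at[OF assms(2)])
  then show ?thesis
    using assms(2) by (auto intro: differentiableI_vector)
qed

lemma times_differentiable_on_add: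
  assumes "open I" "times_differentiable_on n I f" "times_differentiable_on n I g"
  shows "times_differentiable_on n I (\<lambda>t. f t + g t)"
  using assms(2,3)
proof (induction n arbitrary: f g)
  case (Suc n)
  show ?case
    by (rule times_differentiable_on_SucI[OF assms(1)
          has_vector_derivative_add[OF
            times_differentiable_on_has_vector_derivative[OF Suc.prems(1)]
            times_differentiable_on_has_vector_derivative[OF Suc.prems(2)]]])
       (use Suc in auto)
qed simp

lemma (in bounded_linear) times_differentiable_on:
  assumes "open I" "times_differentiable_on n I g"
  shows "times_differentiable_on n I (\<lambda>t. f (g t))"
  using assms(2)
proof (induction n arbitrary: g)
  case (Suc n)
  show ?case
    by (rule times_differentiable_on_SucI[OF assms(1)
          has_vector_derivative[OF times_differentiable_on_has_vector_derivative[OF Suc.prems]]])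
       (use Suc in auto)
qed simp

lemma (in bounded_bilinear) times_differentiable_on:
  assumes "open I" "times_differentiable_on n I f" "times_differentiable_on n I g"
  shows "times_differentiable_on n I (\<lambda>t. prod (f t) (g t))"
  using assms(2,3)
proof (induction n arbitrary: f g)
  case (Suc n)
  show ?case
    by (rule times_differentiable_on_SucI[OF assms(1)
          has_vector_derivative[OF
            times_differentiable_on_has_vector_derivative[OF Suc.prems(1)]
            times_differentiable_on_has_vector_derivative[OF Suc.prems(2)]]
          times_differentiable_on_add[OF assms(1)
            Suc.IH[OF times_differentiable_on_SucD[OF Suc.prems(1)]]
            Suc.IH[OF _ times_differentiable_on_SucD[OF Suc.prems(2)]]]])
       (use Suc.prems in auto)
qed simp

lemma has_vector_derivative_inverse_norm:
  fixes f :: "real \<Rightarrow> 'a::real_inner"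
  assumes f: "(f has_vector_derivative f') (at t)" and "f t \<noteq> 0"
  shows "((\<lambda>t. 1 / norm (f t)) has_vector_derivative
           - ((1 / norm (f t)) * ((1 / norm (f t)) * ((1 / norm (f t)) * (f t \<bullet> f'))))) (at t)"
proof -
  have pos: "f t \<bullet> f t > 0" using assms(2) by simp
  have "((\<lambda>t. f t \<bullet> f t) has_real_derivative 2 * (f t \<bullet> f')) (at t)"
    using bounded_bilinear.has_vector_derivative[OF bounded_bilinear_inner f f]
    by (simp add: has_real_derivative_iff_has_vector_derivative inner_commute)
  then show ?thesis
    unfolding has_real_derivative_iff_has_vector_derivative[symmetric] norm_eq_sqrt_inner
    using pos by (auto intro!: derivative_eq_intros simp: field_simps not_less[symmetric]
        simp del: inner_gt_zero_iff)
qed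

text \<open>
  With \<open>r = 1 / \<parallel>f\<parallel>\<close> one has \<open>r' = - r\<^sup>3 (f \<bullet> f')\<close>: the derivative is a product of \<open>r\<close> itself, \<open>f\<close>
  and \<open>f'\<close>, which closes the induction on the order.
\<close>

lemma times_differentiable_on_inverse_norm:
  fixes f :: "real \<Rightarrow> 'a::real_inner"
  assumes "open I" "times_differentiable_on n I f" "\<And>t. t \<in> I \<Longrightarrow> f t \<noteq> 0"
  shows "times_differentiable_on n I (\<lambda>t. 1 / norm (f t))"
  using assms(2)
proof (induction n)
  case (Suc n)
  let ?r = "\<lambda>t. 1 / norm (f t)"
  have fn: "times_differentiable_on n I f"
    using Suc.prems by (rule times_differentiable_on_SucD)
  have r: "times_differentiable_on n I ?r"
    using Suc.IH fn .
  note mult = bounded_bilinear.times_differentiable_on[OF bounded_bilinear_mult assms(1)]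
  have "times_differentiable_on n I (\<lambda>t. f t \<bullet> vector_derivative f (at t))"
    using bounded_bilinear.times_differentiable_on[OF bounded_bilinear_inner assms(1) fn] Suc.prems
    by simp
  then have "times_differentiable_on n I
      (\<lambda>t. - (?r t * (?r t * (?r t * (f t \<bullet> vector_derivative f (at t))))))"
    by (intro bounded_linear.times_differentiable_on[OF bounded_linear_minus[OF bounded_linear_ident]
          assms(1)] mult r)
  then show ?case
    using times_differentiable_on_SucI[OF assms(1) has_vector_derivative_inverse_norm[OF
            times_differentiable_on_has_vector_derivative[OF Suc.prems] assms(3)]]
    by blast
qed simp

section \<open>Smoothness of the Frenet vectors\<close>

lemma smooth_on_has_vector_derivative:
  assumes "smooth_on I f" "t \<in> I"
  shows "(f has_vector_derivative vector_derivative f (at t)) (at t)"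
  using assms(1) unfolding smooth_on_iff_times_differentiable_on
  by (intro times_differentiable_on_has_vector_derivative[OF _ assms(2)]) blast

lemma smooth_on_cong:
  assumes "open I" "\<And>t. t \<in> I \<Longrightarrow> f t = g t" "smooth_on I f"
  shows "smooth_on I g"
  unfolding smooth_on_iff_times_differentiable_on
proof
  fix n
  show "times_differentiable_on n I g"
    using assms(3) unfolding smooth_on_iff_times_differentiable_on
    by (intro times_differentiable_on_cong[OF assms(1), of f g n] assms(2)) auto
qed

lemma smooth_on_vector_derivative:
  assumes "smooth_on I f"
  shows "smooth_on I (\<lambda>t. vector_derivative f (at t))"
  using assms unfolding smooth_on_iff_times_differentiable_on
  by (metis times_differentiable_on.simps(2))

lemma smooth_on_scaleR_inverse_norm:
  assumes "open I" "smooth_on I f" "smooth_on I g" "\<And>t. t \<in> I \<Longrightarrow> f t \<noteq> 0"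
  shows "smooth_on I (\<lambda>t. (1 / norm (f t)) *\<^sub>R g t)"
  using assms unfolding smooth_on_iff_times_differentiable_on
  by (intro allI bounded_bilinear.times_differentiable_on[OF bounded_bilinear_scaleR]
      times_differentiable_on_inverse_norm) auto

lemma smooth_on_arc_deriv:
  assumes "open I" "smooth_on I \<gamma>" "\<And>t. t \<in> I \<Longrightarrow> speed \<gamma> t > 0" "smooth_on I f"
  shows "smooth_on I (arc_deriv \<gamma> f)"
  using smooth_on_scaleR_inverse_norm[OF assms(1) smooth_on_vector_derivative[OF assms(2)]
      smooth_on_vector_derivative[OF assms(4)]] assms(3)
  unfolding arc_deriv_def[abs_def] speed_def by force

lemma smooth_on_unit_tangent:
  assumes "open I" "frenet_curve I \<gamma>"
  shows "smooth_on I (unit_tangent \<gamma>)"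
  using assms smooth_on_arc_deriv unfolding unit_tangent_def frenet_curve_def by blast

lemma smooth_on_principal_normal:
  assumes "open I" "frenet_curve I \<gamma>"
  shows "smooth_on I (principal_normal \<gamma>)"
proof -
  have "smooth_on I (arc_deriv \<gamma> (unit_tangent \<gamma>))"
    using smooth_on_arc_deriv[OF assms(1) _ _ smooth_on_unit_tangent[OF assms]] assms(2)
    unfolding frenet_curve_def by blast
  from smooth_on_scaleR_inverse_norm[OF assms(1) this this] show ?thesis
    using assms(2) unfolding principal_normal_def[abs_def] frenet_curve_def curvature_def by force
qed

lemma bounded_bilinear_cross3: "bounded_bilinear cross3"
  using bilinear_cross by (simp add: bilinear_conv_bounded_bilinear)

lemma smooth_on_binormal:
  assumes "open I" "frenet_curve I \<gamma>"
  shows "smooth_on I (binormal \<gamma>)"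
  unfolding smooth_on_iff_times_differentiable_on binormal_def[abs_def]
  using smooth_on_unit_tangent[OF assms] smooth_on_principal_normal[OF assms]
  by (intro allI bounded_bilinear.times_differentiable_on[OF bounded_bilinear_cross3 assms(1)])
     (simp_all add: smooth_on_iff_times_differentiable_on)

section \<open>Derivatives of components and constant angles\<close>

lemma has_real_derivative_inner:
  assumes "smooth_on I f" "smooth_on I g" "t \<in> I"
  shows "((\<lambda>t. f t \<bullet> g t) has_real_derivative
           f t \<bullet> vector_derivative g (at t) + vector_derivative f (at t) \<bullet> g t) (at t)"
  using bounded_bilinear.has_vector_derivative[OF bounded_bilinear_inner
      smooth_on_has_vector_derivative[OF assms(1,3)] smooth_on_has_vector_derivative[OF assms(2,3)]]
  by (simp add: has_real_derivative_iff_has_vector_derivative)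

lemma derivative_eq_0_if_constant_on:
  fixes \<phi> :: "real \<Rightarrow> 'a::real_normed_vector"
  assumes "open I" "t \<in> I" "\<And>s. s \<in> I \<Longrightarrow> \<phi> s = a" "(\<phi> has_vector_derivative D) (at t)"
  shows "D = 0"
proof -
  have "((\<lambda>_. a) has_vector_derivative D) (at t)"
    by (rule has_vector_derivative_transform_within_open[OF assms(4,1,2)]) (rule assms(3))
  then show ?thesis
    using vector_derivative_at by fastforce
qed

lemma inner_derivative_swap:
  assumes "open I" "smooth_on I f" "smooth_on I g" "\<And>s. s \<in> I \<Longrightarrow> f s \<bullet> g s = a" "t \<in> I"
  shows "vector_derivative f (at t) \<bullet> g t = - (f t \<bullet> vector_derivative g (at t))"
  using derivative_eq_0_if_constant_on[OF assms(1,5,4)]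
    has_real_derivative_inner[OF assms(2,3,5)]
  by (force simp: has_real_derivative_iff_has_vector_derivative)

text \<open>
  A constant angle between lines only fixes the component along \<open>d\<close> up to sign. Its square is
  constant, however, so twice the product of the component with its derivative is \<open>0\<close>; either the
  component is \<open>0\<close> throughout, or it never is and can be cancelled.
\<close>

lemma inner_derivative_eq_0_if_abs_constant:
  assumes "open I" "smooth_on I f" "\<And>s. s \<in> I \<Longrightarrow> \<bar>f s \<bullet> d\<bar> = a" "t \<in> I"
  shows "vector_derivative f (at t) \<bullet> d = 0"
proof -
  let ?D = "vector_derivative f (at t) \<bullet> d"
  have D: "((\<lambda>s. f s \<bullet> d) has_vector_derivative ?D) (at t)"
    by (rule bounded_linear.has_vector_derivative[OF bounded_linear_inner_left
          smooth_on_has_vector_derivative[OF assms(2,4)]])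
  show ?thesis
  proof (cases "a = 0")
    case True
    then show ?thesis
      using derivative_eq_0_if_constant_on[OF assms(1,4) _ D, of 0] assms(3) by simp
  next
    case False
    have "(f t \<bullet> d) * ?D + ?D * (f t \<bullet> d) = 0"
      by (rule derivative_eq_0_if_constant_on[OF assms(1,4) _ has_vector_derivative_mult[OF D D],
            of "a\<^sup>2"])
         (simp add: assms(3)[symmetric] power2_eq_square)
    moreover have "f t \<bullet> d \<noteq> 0"
      using assms(3)[OF assms(4)] False by auto
    ultimately show ?thesis
      by simp
  qed
qed

lemma norm_unit_tangent:
  assumes "speed \<gamma> t > 0"
  shows "norm (unit_tangent \<gamma> t) = 1"
  using assms by (simp add: unit_tangent_def arc_deriv_def speed_def)

lemma norm_principal_normal:
  assumes "curvature \<gamma> t > 0"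
  shows "norm (principal_normal \<gamma> t) = 1"
  using assms by (simp add: principal_normal_def curvature_def)

lemma slant_helix_derivative_principal_normal:
  assumes "open I" "slant_helix I \<gamma>"
  obtains d where "d \<noteq> 0"
    "\<And>t. t \<in> I \<Longrightarrow> vector_derivative (principal_normal \<gamma>) (at t) \<bullet> d = 0"
proof -
  from assms(2) obtain d \<theta> where fr: "frenet_curve I \<gamma>" and d: "d \<noteq> 0"
    and ang: "\<And>t. t \<in> I \<Longrightarrow> line_angle (principal_normal \<gamma> t) d = \<theta>"
    unfolding slant_helix_def by blast
  have "\<bar>principal_normal \<gamma> t \<bullet> d\<bar> = cos \<theta> * norm d" if "t \<in> I" for t
  proof -
    have n: "norm (principal_normal \<gamma> t) = 1"
      using fr that norm_principal_normal by (simp add: frenet_curve_def)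
    then have "\<bar>principal_normal \<gamma> t \<bullet> d\<bar> / norm d \<le> 1"
      using Cauchy_Schwarz_ineq2[of "principal_normal \<gamma> t" d] d by (simp add: field_simps)
    then have "cos \<theta> = \<bar>principal_normal \<gamma> t \<bullet> d\<bar> / norm d"
      unfolding ang[OF that, symmetric] line_angle_def n
      by (subst cos_arccos_abs) simp_all
    then show ?thesis
      using d by simp
  qed
  from inner_derivative_eq_0_if_abs_constant[OF assms(1) smooth_on_principal_normal[OF assms(1) fr] this]
  show ?thesis
    using that d by blast
qed

section \<open>Spherical curves, plane curves and tangent indicatrices\<close>

text \<open>
  Along a spherical curve \<open>\<beta> \<bullet> T = 0\<close>, hence \<open>T' \<bullet> \<beta> = - (T \<bullet> \<beta>') = - speed\<close>, which is not \<open>0\<close>.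
\<close>

lemma frenet_curve_spherical:
  assumes "open I" "smooth_on I \<beta>" "\<And>t. t \<in> I \<Longrightarrow> speed \<beta> t > 0" "\<And>t. t \<in> I \<Longrightarrow> norm (\<beta> t) = 1"
  shows "frenet_curve I \<beta>"
proof -
  have T: "smooth_on I (unit_tangent \<beta>)"
    unfolding unit_tangent_def by (intro smooth_on_arc_deriv assms)
  have orth: "unit_tangent \<beta> t \<bullet> \<beta> t = 0" if "t \<in> I" for t
    using inner_derivative_swap[OF assms(1,2,2) _ that, of 1] assms(4)
    by (simp add: unit_tangent_def arc_deriv_def inner_commute dot_square_norm)
  have "curvature \<beta> t > 0" if "t \<in> I" for t
  proof -
    have "vector_derivative (unit_tangent \<beta>) (at t) \<bullet> \<beta> t = - speed \<beta> t"
      using inner_derivative_swap[OF assms(1) T assms(2) orth that] assms(3)[OF that]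
      by (simp add: unit_tangent_def[of \<beta>] arc_deriv_def[of \<beta> \<beta> t] dot_square_norm speed_def
          power2_eq_square)
    then have "vector_derivative (unit_tangent \<beta>) (at t) \<noteq> 0"
      using assms(3)[OF that] by auto
    then show ?thesis
      using assms(3)[OF that] by (simp add: curvature_def arc_deriv_def)
  qed
  then show ?thesis
    using assms by (simp add: frenet_curve_def)
qed

text \<open>
  If the tangent component along \<open>d\<close> is constant, so that its derivative vanishes, the principal
  normal, a multiple of the derivative of the tangent, is orthogonal to \<open>d\<close>.
\<close>

lemma principal_normal_orthogonal:
  assumes "vector_derivative (unit_tangent \<gamma>) (at t) \<bullet> d = 0"
  shows "principal_normal \<gamma> t \<bullet> d = 0"
  using assms by (simp add: principal_normal_def arc_deriv_def)

text \<open>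
  Tangent and principal normal are orthogonal to \<open>d\<close>, so the binormal stays parallel to \<open>d\<close>; then so
  does its derivative, which therefore has no component along the principal normal.
\<close>

lemma torsion_eq_0_if_planar:
  assumes "open I" "frenet_curve I \<gamma>" "d \<noteq> 0"
    and planar: "\<And>t. t \<in> I \<Longrightarrow> vector_derivative \<gamma> (at t) \<bullet> d = 0"
    and "t \<in> I"
  shows "torsion \<gamma> t = 0"
proof -
  let ?B' = "vector_derivative (binormal \<gamma>) (at t)"
  have T: "unit_tangent \<gamma> s \<bullet> d = 0" if "s \<in> I" for s
    using planar[OF that] by (simp add: unit_tangent_def arc_deriv_def)
  have N: "principal_normal \<gamma> s \<bullet> d = 0" if "s \<in> I" for s
    by (rule principal_normal_orthogonal,
        rule inner_derivative_eq_0_if_abs_constant[OF assms(1) smooth_on_unit_tangent[OF assms(1,2)]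
          _ that, of d 0])
       (simp add: T)
  have cross_cross: "cross3 (cross3 x y) z = (x \<bullet> z) *\<^sub>R y - (y \<bullet> z) *\<^sub>R x" for x y z :: "real ^ 3"
    using Lagrange[of z x y] by (simp add: cross_skew[of "cross3 x y"] inner_commute)
  have B: "cross3 (binormal \<gamma> s) d = 0" if "s \<in> I" for s
    using T[OF that] N[OF that] by (simp add: binormal_def cross_cross)
  have "((\<lambda>s. cross3 (binormal \<gamma> s) d) has_vector_derivative cross3 ?B' d) (at t)"
    by (rule bounded_linear.has_vector_derivative[OF bounded_bilinear.bounded_linear_left[OF
            bounded_bilinear_cross3]
          smooth_on_has_vector_derivative[OF smooth_on_binormal[OF assms(1,2)] \<open>t \<in> I\<close>]])
  from derivative_eq_0_if_constant_on[OF assms(1) \<open>t \<in> I\<close> B this] have "cross3 ?B' d = 0"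
    by simp
  then have "(?B' \<bullet> d) *\<^sub>R d = (d \<bullet> d) *\<^sub>R ?B'"
    using cross_cross[of ?B' d d] by (metis cross_zero_left right_minus_eq)
  from arg_cong[OF this, of "\<lambda>v. v \<bullet> principal_normal \<gamma> t"]
  have "(?B' \<bullet> d) * (d \<bullet> principal_normal \<gamma> t) = (d \<bullet> d) * (?B' \<bullet> principal_normal \<gamma> t)"
    by simp
  then show ?thesis
    using N[OF \<open>t \<in> I\<close>] assms(3) by (simp add: torsion_def arc_deriv_def inner_commute)
qed

lemma unit_tangent_tangent_indicatrix:
  assumes "speed \<delta> t > 0"
  shows "unit_tangent (tangent_indicatrix \<delta>) t = principal_normal \<delta> t"
  using assms by (simp add: tangent_indicatrix_def principal_normal_def curvature_def arc_deriv_def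
      unit_tangent_def[of "unit_tangent \<delta>"] speed_def[of "unit_tangent \<delta>"])

lemma frenet_curve_tangent_indicatrix:
  assumes "open I" "frenet_curve I \<delta>"
  shows "frenet_curve I (tangent_indicatrix \<delta>)"
proof (rule frenet_curve_spherical[OF assms(1)])
  show "smooth_on I (tangent_indicatrix \<delta>)"
    unfolding tangent_indicatrix_def by (rule smooth_on_unit_tangent[OF assms])
  fix t assume "t \<in> I"
  then have "speed \<delta> t > 0" "curvature \<delta> t > 0"
    using assms(2) by (auto simp: frenet_curve_def)
  then show "speed (tangent_indicatrix \<delta>) t > 0" "norm (tangent_indicatrix \<delta> t) = 1"
    by (auto simp: tangent_indicatrix_def curvature_def arc_deriv_def norm_unit_tangent
        speed_def[of "unit_tangent \<delta>"])
qed

lemma spherical_slant_helix_tangent_indicatrix: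
  assumes "open I" "slant_helix I \<delta>"
  shows "spherical_slant_helix I (tangent_indicatrix \<delta>)"
proof -
  let ?\<beta> = "tangent_indicatrix \<delta>"
  have fr: "frenet_curve I \<delta>"
    using assms(2) by (simp add: slant_helix_def)
  then have speed: "speed \<delta> t > 0" if "t \<in> I" for t
    using that by (simp add: frenet_curve_def)
  obtain d where d: "d \<noteq> 0"
    and N': "\<And>t. t \<in> I \<Longrightarrow> vector_derivative (principal_normal \<delta>) (at t) \<bullet> d = 0"
    using slant_helix_derivative_principal_normal[OF assms] by blast
  have "line_angle (principal_normal ?\<beta> t) d = pi / 2" if "t \<in> I" for t
  proof -
    have "(unit_tangent ?\<beta> has_vector_derivative vector_derivative (principal_normal \<delta>) (at t)) (at t)"
      using smooth_on_has_vector_derivative[OF smooth_on_principal_normal[OF assms(1) fr] that]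
      by (rule has_vector_derivative_transform_within_open[OF _ assms(1) that])
         (simp add: unit_tangent_tangent_indicatrix speed)
    then have "principal_normal ?\<beta> t \<bullet> d = 0"
      using N'[OF that] by (intro principal_normal_orthogonal) (simp add: vector_derivative_at)
    then show ?thesis
      by (simp add: line_angle_def)
  qed
  moreover have "?\<beta> ` I \<subseteq> sphere 0 1"
    using speed by (auto simp: tangent_indicatrix_def norm_unit_tangent)
  ultimately show ?thesis
    using frenet_curve_tangent_indicatrix[OF assms(1) fr] d
    unfolding spherical_slant_helix_def slant_helix_def by blast
qed

section \<open>The involute\<close>

lemma unit_tangent_involute:
  assumes "open I" "frenet_curve I \<gamma>"
    and arc_length: "\<And>s. s \<in> I \<Longrightarrow> speed \<gamma> s = 1" and "s \<in> I" "c - s > 0"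
  shows "unit_tangent (involute c \<gamma>) s = principal_normal \<gamma> s"
proof -
  let ?k = "curvature \<gamma> s" and ?N = "principal_normal \<gamma> s" and ?T = "unit_tangent \<gamma>"
  have k: "?k > 0"
    using assms by (simp add: frenet_curve_def)
  have T: "?T s = vector_derivative \<gamma> (at s)"
    using arc_length[OF \<open>s \<in> I\<close>] by (simp add: unit_tangent_def arc_deriv_def)
  have T': "vector_derivative ?T (at s) = ?k *\<^sub>R ?N"
    using k arc_length[OF \<open>s \<in> I\<close>] by (simp add: principal_normal_def arc_deriv_def)
  have "(\<gamma> has_vector_derivative ?T s) (at s)"
    using smooth_on_has_vector_derivative assms(2,4) unfolding T frenet_curve_def by blast
  moreover have "(?T has_vector_derivative ?k *\<^sub>R ?N) (at s)"
    using smooth_on_has_vector_derivative[OF smooth_on_unit_tangent[OF assms(1,2)] \<open>s \<in> I\<close>]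
    unfolding T' .
  moreover have "((\<lambda>s. c - s) has_real_derivative -1) (at s)"
    by (auto intro!: derivative_eq_intros)
  ultimately have "(involute c \<gamma> has_vector_derivative
      ?T s + ((c - s) *\<^sub>R (?k *\<^sub>R ?N) + (-1) *\<^sub>R ?T s)) (at s)"
    unfolding involute_def[abs_def]
    by (intro has_vector_derivative_add has_vector_derivative_scaleR)
  then have "vector_derivative (involute c \<gamma>) (at s) = ((c - s) * ?k) *\<^sub>R ?N"
    by (simp add: vector_derivative_at)
  then show ?thesis
    using k \<open>c - s > 0\<close> norm_principal_normal[OF k]
    by (simp add: unit_tangent_def arc_deriv_def speed_def)
qed

text \<open>
  The principal normal is a regular curve: \<open>N \<bullet> T = 0\<close> gives \<open>N' \<bullet> T = - (N \<bullet> T')\<close>, which is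
  \<open>- speed \<cdot> curvature\<close> and hence not \<open>0\<close>.
\<close>

lemma frenet_curve_principal_normal:
  assumes "open I" "frenet_curve I \<gamma>"
  shows "frenet_curve I (principal_normal \<gamma>)"
proof (rule frenet_curve_spherical[OF assms(1) smooth_on_principal_normal[OF assms]])
  let ?T = "unit_tangent \<gamma>" and ?N = "principal_normal \<gamma>"
  have pos: "speed \<gamma> t > 0" "curvature \<gamma> t > 0" if "t \<in> I" for t
    using assms(2) that by (auto simp: frenet_curve_def)
  have T: "smooth_on I ?T"
    by (rule smooth_on_unit_tangent[OF assms])
  have T': "vector_derivative ?T (at t) = (speed \<gamma> t * curvature \<gamma> t) *\<^sub>R ?N t" if "t \<in> I" for t
    using pos[OF that] by (simp add: principal_normal_def arc_deriv_def)
  fix t assume t: "t \<in> I"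
  show norm_N: "norm (?N t) = 1"
    using norm_principal_normal pos t by blast
  have orth: "?N s \<bullet> ?T s = 0" if "s \<in> I" for s
    using inner_derivative_swap[OF assms(1) T T _ that, of 1] norm_unit_tangent[OF pos(1)] pos[OF that]
    by (simp add: T'[OF that] dot_square_norm inner_commute)
  have "vector_derivative ?N (at t) \<bullet> ?T t = - (speed \<gamma> t * curvature \<gamma> t)"
    using inner_derivative_swap[OF assms(1) smooth_on_principal_normal[OF assms] T orth t]
    by (simp add: T'[OF t] dot_square_norm norm_N)
  then have "vector_derivative ?N (at t) \<noteq> 0"
    using pos[OF t] by auto
  then show "speed ?N t > 0"
    by (simp add: speed_def)
qed

theorem theorem8:
  fixes \<gamma> :: "real \<Rightarrow> real ^ 3" and I :: "real set" and c :: real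
  assumes "open I" and "is_interval I"
    and "smooth_on I \<gamma>"
    and "\<forall>s\<in>I. norm (vector_derivative \<gamma> (at s)) = 1"
    and "\<forall>s\<in>I. curvature \<gamma> s \<noteq> 0"
    and "\<forall>s\<in>I. c - s > 0"
  shows "(slant_helix I \<gamma> \<longrightarrow> generalized_helix I (tangent_indicatrix (involute c \<gamma>))) \<and>
         (slant_helix I (involute c \<gamma>) \<longrightarrow>
            spherical_slant_helix I (tangent_indicatrix (involute c \<gamma>)))"
proof (intro conjI impI)
  let ?\<beta> = "tangent_indicatrix (involute c \<gamma>)" and ?N = "principal_normal \<gamma>"
  assume slant: "slant_helix I \<gamma>"
  then have fr: "frenet_curve I \<gamma>"
    by (simp add: slant_helix_def)
  have \<beta>: "?N s = ?\<beta> s" if "s \<in> I" for s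
    using unit_tangent_involute[OF assms(1) fr _ that] assms(4,6) that
    by (simp add: tangent_indicatrix_def speed_def)
  have N: "frenet_curve I ?N"
    by (rule frenet_curve_principal_normal[OF assms(1) fr])
  have \<beta>': "vector_derivative ?\<beta> (at s) = vector_derivative ?N (at s)" if "s \<in> I" for s
    by (rule vector_derivative_at, rule has_vector_derivative_transform_within_open[OF
          smooth_on_has_vector_derivative[OF smooth_on_principal_normal[OF assms(1) fr] that]
          assms(1) that \<beta>])
  have fr_\<beta>: "frenet_curve I ?\<beta>"
    using N \<beta> smooth_on_principal_normal[OF assms(1) fr]
    by (intro frenet_curve_spherical[OF assms(1)] smooth_on_cong[OF assms(1) \<beta>])
       (auto simp: speed_def \<beta>' frenet_curve_def \<beta>[symmetric] fr[unfolded frenet_curve_def]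
         norm_principal_normal)
  obtain d where "d \<noteq> 0" "\<And>s. s \<in> I \<Longrightarrow> vector_derivative ?N (at s) \<bullet> d = 0"
    using slant_helix_derivative_principal_normal[OF assms(1) slant] by blast
  then have "torsion ?\<beta> s = 0" if "s \<in> I" for s
    using torsion_eq_0_if_planar[OF assms(1) fr_\<beta> _ _ that, of d] by (simp add: \<beta>')
  then show "generalized_helix I ?\<beta>"
    using fr_\<beta> by (simp add: generalized_helix_def)
next
  assume "slant_helix I (involute c \<gamma>)"
  then show "spherical_slant_helix I (tangent_indicatrix (involute c \<gamma>))"
    by (rule spherical_slant_helix_tangent_indicatrix[OF assms(1)])
qed

end
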